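(* For all integers $k\geq 1$, the Bernoulli numbers $B_n$ and the Euler numbers $E_n$ are related by the two formulas $$\sum_{j=1}^k \binom{k}{j} 2^j\, \frac{2^{j+1}-1}{j+1}B_{j+1}=\frac{1}{2}-\frac{(-1)^{\lfloor k/2\rfloor} E_{k}}{2}$$ and $$2^{k+1}\,\frac{2^{k+1}-1}{k+1}B_{k+1}=\sum_{j=0}^{k}\binom{k}{j}(-1)^{\lfloor j/2\rfloor}E_j.$$
   Context: The Bernoulli numbers $B_n$ are defined by $\frac{z}{e^z-1}=\sum_{k=0}^\infty \frac{B_k}{k!}z^k$ for $|z|<2\pi$; thus $B_0=1$, $B_1=-\frac12$, $B_2=\frac16$. The Euler numbers $E_n$ are defined as the coefficients in the Taylor expansion of the secant at $0$: $\sec(z)=\frac{1}{\cos z}=\sum_{n=0}^\infty \frac{E_n}{n!}z^n$ for $|z|<\frac{\pi}{2}$; thus $E_0=1$, $E_2=1$ (no alternating signs), and $E_n=0$ for odd $n$. $\lfloor\cdot\rfloor$ denotes the floor function. *)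

theory Defs
  imports "HOL-Complex_Analysis.Complex_Analysis"
begin

text \<open>The quotient \<open>z / (e\<^sup>z - 1)\<close> has a removable singularity at \<open>0\<close>, where division
  by zero would give \<open>0\<close> instead of the limit \<open>1\<close>.\<close>

definition bernoulli_gf :: "complex \<Rightarrow> complex" where
  "bernoulli_gf z = (if z = 0 then 1 else z / (exp z - 1))"

definition bernoulli :: "nat \<Rightarrow> real" where
  "bernoulli = (THE B. \<forall>z. norm z < 2 * pi \<longrightarrow>
     (\<lambda>n. of_real (B n) / fact n * z ^ n) sums bernoulli_gf z)"

text \<open>The Euler numbers are the coefficients of the secant, without alternating signs:
  \<open>E\<^sub>0 = 1\<close>, \<open>E\<^sub>2 = 1\<close>, \<open>E\<^sub>4 = 5\<close>.\<close>

definition euler :: "nat \<Rightarrow> real" where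
  "euler = (THE E. \<forall>z::complex. norm z < pi / 2 \<longrightarrow>
     (\<lambda>n. of_real (E n) / fact n * z ^ n) sums (1 / cos z))"

text \<open>Both descriptions determine a unique real sequence.\<close>

lemma real_taylor_coeffs_ex1:
  assumes r: "r > 0" and hol: "f holomorphic_on ball 0 r"
    and cnj: "\<And>z. norm z < r \<Longrightarrow> f (cnj z) = cnj (f z)"
  shows "\<exists>!a::nat \<Rightarrow> real. \<forall>z. norm z < r \<longrightarrow>
           (\<lambda>n. of_real (a n) / fact n * z ^ n) sums f z"
proof -
  have ev: "\<forall>\<^sub>F z in nhds (0::complex). norm z < r"
    using eventually_nhds_ball[OF r, of "0::complex"] by (simp add: dist_commute)
  have uniq: "c = d"
    if "\<And>z. norm z < r \<Longrightarrow> (\<lambda>n. c n * z ^ n) sums f z"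
       "\<And>z. norm z < r \<Longrightarrow> (\<lambda>n. d n * z ^ n) sums f z" for c d :: "nat \<Rightarrow> complex"
  proof -
    have "f has_fps_expansion Abs_fps c" "f has_fps_expansion Abs_fps d"
      by (rule has_fps_expansionI, rule eventually_mono[OF ev], simp add: that)+
    then have "Abs_fps c = Abs_fps d"
      by (rule fps_expansion_unique_complex)
    then show ?thesis by (simp add: Abs_fps_inject)
  qed
  define c where "c n = (deriv ^^ n) f 0 / fact n" for n
  have c: "(\<lambda>n. c n * z ^ n) sums f z" if "norm z < r" for z
    using holomorphic_power_series[OF hol, of z] that by (simp add: c_def)
  have "(\<lambda>n. cnj (c n) * z ^ n) sums f z" if "norm z < r" for z
  proof -
    have "(\<lambda>n. cnj (c n * cnj z ^ n)) sums cnj (f (cnj z))"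
      using c[of "cnj z"] that by (simp only: sums_cnj complex_mod_cnj)
    then show ?thesis using cnj[OF that] by simp
  qed
  then have "(\<lambda>n. cnj (c n)) = c" using c by (intro uniq)
  then have real: "of_real (Re (c n)) = c n" for n
    by (metis Reals_cnj_iff of_real_Re)
  show ?thesis
  proof (rule ex1I)
    show "\<forall>z. norm z < r \<longrightarrow> (\<lambda>n. of_real (fact n * Re (c n)) / fact n * z ^ n) sums f z"
      using c by (simp add: real)
  next
    fix a :: "nat \<Rightarrow> real"
    assume "\<forall>z. norm z < r \<longrightarrow> (\<lambda>n. of_real (a n) / fact n * z ^ n) sums f z"
    then have eq: "(\<lambda>n. of_real (a n) / fact n) = c" using c by (intro uniq) auto
    show "a = (\<lambda>n. fact n * Re (c n))"
    proof
      fix n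
      have "complex_of_real (a n) = fact n * c n"
        using fun_cong[OF eq, of n] by (simp add: field_simps)
      also have "\<dots> = of_real (fact n * Re (c n))" by (simp add: real)
      finally show "a n = fact n * Re (c n)" by (simp only: of_real_eq_iff)
    qed
  qed
qed

lemma exp_ne_1_ball:
  fixes z :: complex
  assumes "norm z < 2 * pi" "z \<noteq> 0"
  shows "exp z \<noteq> 1"
proof
  assume "exp z = 1"
  then obtain n :: int where n: "Re z = 0" "Im z = of_int (2 * n) * pi"
    by (auto simp: exp_eq_1)
  then have "n \<noteq> 0" using \<open>z \<noteq> 0\<close> by (auto simp: complex_eq_iff)
  then have "1 \<le> \<bar>of_int n\<bar> * (1::real)" by linarith
  then have "2 * pi \<le> \<bar>Im z\<bar>" by (simp add: n abs_mult)
  then show False using abs_Im_le_cmod[of z] assms by linarith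
qed

lemma cos_ne_0_ball:
  fixes z :: complex
  assumes "norm z < pi / 2"
  shows "cos z \<noteq> 0"
proof
  assume "cos z = 0"
  then obtain n :: int where "z = of_real (n * pi) + of_real pi / 2"
    by (auto simp: cos_eq_0)
  then have "Re z = Re (of_real (n * pi) + of_real pi / 2)" by (rule arg_cong)
  also have "\<dots> = n * pi + pi / 2" by simp
  finally have z: "Re z = (2 * of_int n + 1) * (pi / 2)" by (simp add: field_simps)
  have "1 \<le> \<bar>2 * n + 1\<bar>" by presburger
  then have "real_of_int 1 \<le> of_int \<bar>2 * n + 1\<bar>" by (simp only: of_int_le_iff)
  then have "1 \<le> \<bar>2 * of_int n + 1 :: real\<bar>" by simp
  then have "pi / 2 \<le> \<bar>Re z\<bar>" by (simp add: z abs_mult)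
  then show False using abs_Re_le_cmod[of z] assms by linarith
qed

lemma bernoulli_gf_holomorphic: "bernoulli_gf holomorphic_on ball 0 (2 * pi)"
proof -
  have "(\<lambda>z. (exp z - 1) / z) \<midarrow>0\<rightarrow> (1::complex)"
    using DERIV_exp[of "0::complex"] by (simp add: DERIV_def)
  then have "(\<lambda>z. inverse ((exp z - 1) / z)) \<midarrow>0\<rightarrow> inverse (1::complex)"
    by (rule tendsto_inverse) simp
  then have lim: "(\<lambda>z. z / (exp z - 1)) \<midarrow>0\<rightarrow> (1::complex)" by simp
  have "(\<lambda>z::complex. z / (exp z - 1)) holomorphic_on ball 0 (2 * pi) - {0}"
    by (intro holomorphic_intros) (auto dest: exp_ne_1_ball)
  from removable_singularity[OF this open_ball lim] show ?thesis
    by (simp add: bernoulli_gf_def[abs_def])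
qed

lemma bernoulli_sums:
  assumes "norm z < 2 * pi"
  shows "(\<lambda>n. of_real (bernoulli n) / fact n * z ^ n) sums bernoulli_gf z"
proof -
  have "\<exists>!B::nat \<Rightarrow> real. \<forall>z. norm z < 2 * pi \<longrightarrow>
          (\<lambda>n. of_real (B n) / fact n * z ^ n) sums bernoulli_gf z"
    by (rule real_taylor_coeffs_ex1[OF _ bernoulli_gf_holomorphic])
       (simp_all add: bernoulli_gf_def exp_cnj)
  from theI'[OF this] show ?thesis using assms unfolding bernoulli_def by blast
qed

lemma euler_sums:
  fixes z :: complex
  assumes "norm z < pi / 2"
  shows "(\<lambda>n. of_real (euler n) / fact n * z ^ n) sums (1 / cos z)"
proof -
  have hol: "(\<lambda>z::complex. 1 / cos z) holomorphic_on ball 0 (pi / 2)"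
    by (intro holomorphic_intros) (use cos_ne_0_ball in auto)
  have "\<exists>!E::nat \<Rightarrow> real. \<forall>z::complex. norm z < pi / 2 \<longrightarrow>
          (\<lambda>n. of_real (E n) / fact n * z ^ n) sums (1 / cos z)"
    by (rule real_taylor_coeffs_ex1[OF _ hol]) (simp_all add: cnj_cos)
  from theI'[OF this] show ?thesis using assms unfolding euler_def by blast
qed

end

theory Submission
  imports Defs
begin

text \<open>Let \<open>T = \<Sum>\<^sub>j 2\<^sup>j (2\<^bsup>j+1\<^esup> - 1) / (j + 1) B\<^bsub>j+1\<^esub> X\<^sup>j / j!\<close> and let \<open>S\<close> be the expansion of the
  hyperbolic secant, obtained from that of the secant by the substitution \<open>X \<mapsto> \<i> X\<close>. Then
  \<open>T = -1 / (e\<^bsup>2X\<^esup> + 1)\<close> and \<open>S = 2 e\<^sup>X / (e\<^bsup>2X\<^esup> + 1)\<close>, so that \<open>2 e\<^sup>X T = -S\<close> and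
  \<open>e\<^sup>X S = 2 + 2 T\<close>. The two formulas compare coefficients in these identities: multiplication
  by \<open>e\<^sup>X\<close> is the binomial transform.\<close>

definition egf :: "(nat \<Rightarrow> real) \<Rightarrow> complex fps" where
  "egf a = Abs_fps (\<lambda>n. of_real (a n) / fact n)"

lemma egf_nth: "fps_nth (egf a) n = of_real (a n) / fact n"
  by (simp add: egf_def)

lemma egf_has_fps_expansion:
  assumes "r > 0"
    and "\<And>z. norm z < r \<Longrightarrow> (\<lambda>n. of_real (a n) / fact n * z ^ n) sums f z"
  shows "f has_fps_expansion egf a"
proof (rule has_fps_expansionI)
  have "\<forall>\<^sub>F z in nhds (0::complex). norm z < r"
    using eventually_nhds_ball[OF assms(1), of "0::complex"] by (simp add: dist_commute)
  then show "\<forall>\<^sub>F z in nhds 0. (\<lambda>n. fps_nth (egf a) n * z ^ n) sums f z"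
    unfolding egf_nth by eventually_elim (rule assms(2))
qed

lemma egf_mult_exp:
  "egf a * fps_exp 1 = egf (\<lambda>n. \<Sum>j = 0..n. real (n choose j) * a j)"
proof (rule fps_ext)
  fix n
  have "fps_nth (egf a * fps_exp 1) n = (\<Sum>j = 0..n. of_real (a j) / fact j * (1 / fact (n - j)))"
    by (simp add: fps_mult_nth egf_nth)
  also have "\<dots> = (\<Sum>j = 0..n. of_real (real (n choose j) * a j) / fact n)"
    by (intro sum.cong refl) (simp add: binomial_fact field_simps)
  finally show "fps_nth (egf a * fps_exp 1) n = fps_nth (egf (\<lambda>n. \<Sum>j = 0..n. real (n choose j) * a j)) n"
    by (simp add: egf_nth sum_divide_distrib)
qed

text \<open>Uniqueness of expansions turns the analytic identity near 0 into a formal one. It is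
  kept as a product because \<open>fps_exp 1 - 1\<close> has constant coefficient 0 and so is not a
  unit.\<close>

lemma egf_bernoulli: "egf bernoulli * (fps_exp 1 - 1) = fps_X"
proof -
  have "bernoulli_gf has_fps_expansion egf bernoulli"
    by (rule egf_has_fps_expansion[of "2 * pi"]) (use bernoulli_sums in auto)
  then have "(\<lambda>z. bernoulli_gf z * (exp z - 1)) has_fps_expansion egf bernoulli * (fps_exp 1 - 1)"
    by (intro fps_expansion_intros)
  moreover have ev: "\<forall>\<^sub>F z in nhds 0. bernoulli_gf z * (exp z - 1) = z"
  proof -
    have "\<forall>\<^sub>F z in nhds (0::complex). z \<in> ball 0 (2 * pi)"
      by (intro eventually_nhds_in_open) auto
    then show ?thesis
      by eventually_elim (auto simp: bernoulli_gf_def dest: exp_ne_1_ball)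
  qed
  ultimately have "(\<lambda>z. z) has_fps_expansion egf bernoulli * (fps_exp 1 - 1)"
    by (simp only: has_fps_expansion_cong[OF ev refl])
  then show ?thesis
    using has_fps_expansion_fps_X fps_expansion_unique_complex by blast
qed

lemma egf_euler: "egf euler * fps_cos 1 = 1"
proof -
  have "(\<lambda>z. 1 / cos z) has_fps_expansion egf euler"
    by (rule egf_has_fps_expansion[of "pi / 2"]) (use euler_sums in auto)
  then have "(\<lambda>z. 1 / cos z * cos z) has_fps_expansion egf euler * fps_cos 1"
    by (intro fps_expansion_intros)
  moreover have ev: "\<forall>\<^sub>F z in nhds 0. 1 / cos z * cos z = (1::complex)"
  proof -
    have "\<forall>\<^sub>F z in nhds (0::complex). z \<in> ball 0 (pi / 2)"
      by (intro eventually_nhds_in_open) auto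
    then show ?thesis
      by eventually_elim (use cos_ne_0_ball in auto)
  qed
  ultimately have "(\<lambda>z. 1) has_fps_expansion egf euler * fps_cos 1"
    by (simp only: has_fps_expansion_cong[OF ev refl])
  then show ?thesis
    using has_fps_expansion_1 fps_expansion_unique_complex by blast
qed

text \<open>Exponentials replace the cosine because a substitution of c X for X merely rescales the
  parameter of \<open>fps_exp\<close>.\<close>

lemma egf_euler_exp:
  "egf euler * (fps_exp \<i> + fps_exp (- \<i>)) = 2"
proof -
  have "fps_exp \<i> + fps_exp (- \<i>) = 2 * fps_cos (1::complex)"
    using fps_exp_ii_sin_cos[of 1] fps_exp_minus_ii_sin_cos[of 1] by simp
  then show ?thesis
    using egf_euler by (simp add: mult.left_commute)
qed

text \<open>The exponential factor is invariant under the reflection of X to -X, so the secant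
  series and its reflection have the same product with it. Formal power series over the complex
  numbers form an integral domain, so the factor cancels.\<close>

lemma euler_odd:
  assumes "odd n"
  shows "euler n = 0"
proof -
  let ?F = "egf euler" and ?G = "egf euler oo (- fps_X)"
    and ?C = "fps_exp \<i> + fps_exp (- \<i>)"
  have "(?F * ?C) oo (- fps_X) = 2 oo (- fps_X)"
    by (simp only: egf_euler_exp)
  then have "?G * ?C = 2"
    by (simp add: fps_compose_mult_distrib fps_compose_add_distrib add.commute)
  then have "?G * ?C = ?F * ?C" by (simp add: egf_euler_exp)
  moreover have "?C \<noteq> 0" using egf_euler_exp by auto
  ultimately have "?G = ?F" by simp
  then have "fps_nth ?G n = fps_nth ?F n" by simp
  then have "(- 1) ^ n * fps_nth ?F n = fps_nth ?F n"
    by (simp only: fps_compose_uminus' fps_nth_Abs_fps)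
  then show ?thesis using assms by (simp add: egf_nth)
qed

lemma egf_sech:
  "egf (\<lambda>n. (- 1) ^ (n div 2) * euler n) * (fps_exp 2 + 1) = 2 * fps_exp 1"
proof -
  have "egf (\<lambda>n. (- 1) ^ (n div 2) * euler n) = egf euler oo (fps_const \<i> * fps_X)"
  proof (rule fps_ext)
    fix n
    show "fps_nth (egf (\<lambda>n. (- 1) ^ (n div 2) * euler n)) n
      = fps_nth (egf euler oo (fps_const \<i> * fps_X)) n"
    \<comment> \<open>The substitution contributes i^n, which is (-1)^(n div 2) for even n; for odd
      n both sides vanish by \<open>euler_odd\<close>.\<close>
    proof (cases "even n")
      case True
      then obtain m where "n = 2 * m" by blast
      then show ?thesis by (simp add: egf_nth power_mult)
    qed (simp add: egf_nth euler_odd)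
  qed
  moreover have "(egf euler oo (fps_const \<i> * fps_X)) * (fps_exp (- 1) + fps_exp 1) = 2"
  proof -
    have "(egf euler * (fps_exp \<i> + fps_exp (- \<i>))) oo (fps_const \<i> * fps_X)
        = 2 oo (fps_const \<i> * fps_X)"
      by (simp only: egf_euler_exp)
    then show ?thesis
      by (simp add: fps_compose_mult_distrib fps_compose_add_distrib)
  qed
  moreover have "fps_exp 2 + 1 = (fps_exp (- 1) + fps_exp 1) * fps_exp (1::complex)"
    using fps_exp_add_mult[of "-1" "1::complex"] fps_exp_add_mult[of 1 "1::complex"]
    by (simp add: algebra_simps)
  ultimately show ?thesis by (simp flip: mult.assoc)
qed

text \<open>These are the derivatives at 0 of (tanh x - 1) / 2 = -1 / (e^(2x) + 1).\<close>

definition tangent_coeff :: "nat \<Rightarrow> real" where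
  "tangent_coeff n = 2 ^ n * ((2 ^ (n + 1) - 1) / real (n + 1)) * bernoulli (n + 1)"

text \<open>With B(x) = x / (e^x - 1), the series of \<open>tangent_coeff\<close> times 2x is B(4x)
  - B(2x). Since e^(4x) - 1 = (e^(2x) - 1) (e^(2x) + 1), this difference collapses to -2x / (e^(2x)
  + 1).\<close>

lemma egf_tangent_coeff: "egf tangent_coeff * (fps_exp 2 + 1) = - 1"
proof -
  define B where "B c = egf bernoulli oo (fps_const c * fps_X)" for c
  have B: "B c * (fps_exp c - 1) = fps_const c * fps_X" for c
  proof -
    have "(egf bernoulli * (fps_exp 1 - 1)) oo (fps_const c * fps_X) = fps_const c * fps_X"
      by (simp add: egf_bernoulli)
    then show ?thesis
      by (simp add: fps_compose_mult_distrib fps_compose_sub_distrib B_def)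
  qed
  have B_nth: "fps_nth (B c) n = c ^ n * (of_real (bernoulli n) / fact n)" for c n
    by (simp add: B_def egf_nth)
  \<comment> \<open>The constant terms cancel. For n = m + 1, the factor 4^n - 2^n = 2^n (2^n - 1)
    and n! = (m + 1) m! yield the coefficient at m.\<close>
  have T: "2 * fps_X * egf tangent_coeff = B 4 - B 2"
  proof (rule fps_ext)
    fix n
    show "fps_nth (2 * fps_X * egf tangent_coeff) n = fps_nth (B 4 - B 2) n"
    proof (cases n)
      case 0
      then show ?thesis by (simp add: B_nth mult.assoc numeral_fps_const)
    next
      case (Suc m)
      have "(4::complex) ^ m = 2 ^ m * 2 ^ m" by (simp flip: power_mult_distrib)
      then show ?thesis
        using Suc
        by (simp add: B_nth egf_nth tangent_coeff_def mult.assoc numeral_fps_const field_simps)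
          (simp flip: add_divide_distrib)
    qed
  qed
  have E: "fps_exp 4 = fps_exp 2 * fps_exp (2::complex)"
    using fps_exp_add_mult[of 2 "2::complex"] by simp
  let ?P = "fps_exp (2::complex)"
  \<comment> \<open>The extra factor clears the denominators of both Bernoulli series; it is nonzero
    and is cancelled at the end.\<close>
  have "2 * fps_X * (?P - 1) * (egf tangent_coeff * (?P + 1)) = (B 4 - B 2) * ((?P - 1) * (?P + 1))"
    by (simp only: T[symmetric] ac_simps)
  also have "\<dots> = B 4 * (fps_exp 4 - 1) - B 2 * (?P - 1) * (?P + 1)"
    by (simp add: E algebra_simps)
  also have "\<dots> = 2 * fps_X * (?P - 1) * (- 1)"
    by (simp only: B numeral_fps_const[symmetric]) (simp add: algebra_simps)
  finally have "2 * fps_X * (?P - 1) * (egf tangent_coeff * (?P + 1)) = 2 * fps_X * (?P - 1) * (- 1)" .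
  moreover have "2 * fps_X * (?P - 1) \<noteq> 0"
    using fps_exp_eq_iff[of 2 "0::complex"] by simp
  ultimately show ?thesis using mult_left_cancel by blast
qed

text \<open>This is the term j = 0, absent from the sum in the first formula; it accounts for the
  1/2 there.\<close>

lemma tangent_coeff_0: "tangent_coeff 0 = - 1 / 2"
proof -
  have "fps_nth (egf tangent_coeff * (fps_exp 2 + 1)) 0 = - 1"
    by (simp add: egf_tangent_coeff)
  then have "complex_of_real (2 * tangent_coeff 0) = of_real (- 1)"
    by (simp add: egf_nth mult.commute)
  then have "2 * tangent_coeff 0 = - 1" by (simp only: of_real_eq_iff)
  then show ?thesis by simp
qed

theorem proposition3:
  fixes k :: nat
  assumes "k \<ge> 1"
  shows "(\<Sum>j = 1..k. real (k choose j) * 2 ^ j * ((2 ^ (j + 1) - 1) / real (j + 1)) * bernoulli (j + 1))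
           = 1 / 2 - (-1) ^ (k div 2) * euler k / 2
         \<and> 2 ^ (k + 1) * ((2 ^ (k + 1) - 1) / real (k + 1)) * bernoulli (k + 1)
           = (\<Sum>j = 0..k. real (k choose j) * (-1) ^ (j div 2) * euler j)"
proof -
  define s where "s n = (- 1) ^ (n div 2) * euler n" for n
  let ?S = "egf s" and ?T = "egf tangent_coeff" and ?P = "fps_exp (2::complex)"
  have S: "?S * (?P + 1) = 2 * fps_exp 1"
    using egf_sech by (simp add: s_def[abs_def])
  have P: "fps_exp 1 * fps_exp 1 = ?P"
    using fps_exp_add_mult[of 1 "1::complex"] by simp
  have "fps_nth (?P + 1) 0 \<noteq> 0" by simp
  then have nz: "?P + 1 \<noteq> 0" by (metis fps_zero_nth)
  have "(2 * (?T * fps_exp 1)) * (?P + 1) = 2 * fps_exp 1 * (?T * (?P + 1))"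
    by (simp only: ac_simps)
  also have "\<dots> = (- ?S) * (?P + 1)"
    by (simp add: egf_tangent_coeff S)
  finally have 1: "2 * (?T * fps_exp 1) = - ?S" using nz mult_right_cancel by blast
  have "(?S * fps_exp 1) * (?P + 1) = fps_exp 1 * (?S * (?P + 1))"
    by (simp only: ac_simps)
  \<comment> \<open>The product is 2 e^(2X) = 2 (e^(2X) + 1) - 2, where -2 equals 2 T (e^(2X) +
    1).\<close>
  also have "\<dots> = 2 * (?P + 1) + 2 * (?T * (?P + 1))"
    unfolding S egf_tangent_coeff by (simp add: P[symmetric] algebra_simps)
  also have "\<dots> = (2 + 2 * ?T) * (?P + 1)"
    by (simp only: distrib_right mult.assoc)
  finally have 2: "?S * fps_exp 1 = 2 + 2 * ?T" using nz mult_right_cancel by blast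

  have "complex_of_real (2 * (\<Sum>j = 0..k. real (k choose j) * tangent_coeff j)) = of_real (- s k)"
    using arg_cong[OF 1, of "\<lambda>f. fps_nth f k"]
    by (simp add: egf_mult_exp egf_nth numeral_fps_const) (simp add: field_simps)
  then have "2 * (\<Sum>j = 0..k. real (k choose j) * tangent_coeff j) = - s k"
    by (simp only: of_real_eq_iff)
  moreover have "(\<Sum>j = 0..k. real (k choose j) * tangent_coeff j)
      = - 1 / 2 + (\<Sum>j = 1..k. real (k choose j) * tangent_coeff j)"
    by (simp add: sum.atLeast_Suc_atMost tangent_coeff_0)
  ultimately have "(\<Sum>j = 1..k. real (k choose j) * tangent_coeff j) = 1 / 2 - s k / 2"
    by simp
  \<comment> \<open>As k \<ge> 1, the constant 2 in \<open>2 + 2 * ?T\<close> does not contribute to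
    coefficient k.\<close>
  moreover have "complex_of_real (\<Sum>j = 0..k. real (k choose j) * s j) = of_real (2 * tangent_coeff k)"
    using arg_cong[OF 2, of "\<lambda>f. fps_nth f k"] assms
    by (simp add: egf_mult_exp egf_nth numeral_fps_const)
  then have "2 * tangent_coeff k = (\<Sum>j = 0..k. real (k choose j) * s j)"
    by (simp only: of_real_eq_iff)
  ultimately show ?thesis
    by (simp add: tangent_coeff_def s_def mult.assoc)
qed

end
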